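(* Let $n\geq 3$ be an integer and let $m$ be an integer with $m\geq 2n$. Then the b-chromatic number of the Kneser graph $KG(m,n)$ satisfies $$\chi_b(KG(m,n))\;\geq\; 2\binom{\lfloor m/2\rfloor}{n}.$$
   Context: For a positive integer $m$, $[m]$ denotes the set $\{0,1,\ldots,m-1\}$, and for a set $X$, $\binom{X}{n}$ denotes the collection of all $n$-element subsets of $X$. For $m\geq 2n$, the Kneser graph $KG(m,n)$ is the graph with vertex set $\binom{[m]}{n}$ in which two vertices $A$ and $B$ are adjacent if and only if $A\cap B=\emptyset$. The b-chromatic number $\chi_b(G)$ of a graph $G$ is the largest positive integer $t$ such that there exists a proper vertex coloring of $G$ with $t$ colors (all $t$ color classes nonempty) in which every color class contains at least one vertex that has a neighbor in each of the other color classes. In the displayed inequality $\binom{\lfloor m/2\rfloor}{n}$ is the usual binomial coefficient. *)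

theory Defs
  imports "Graph_Theory.Pair_Digraph" "HOL-Library.Ramsey"
begin

(* Finite simple graphs are the instances of the locale pair_graph: an edge {u, v} is
   represented by the two arcs (u, v) and (v, u). *)
definition kneser_graph :: "nat \<Rightarrow> nat \<Rightarrow> nat set pair_pre_digraph" where
  "kneser_graph m n =
     \<lparr> pverts = nsets {0..<m} n,
       parcs = {(A, B). A \<in> nsets {0..<m} n \<and> B \<in> nsets {0..<m} n \<and> A \<inter> B = {}} \<rparr>"

lemma pair_graph_kneser_graph:
  assumes "n \<ge> 1"
  shows "pair_graph (kneser_graph m n)"
proof -
  let ?V = "nsets {0..<m} n"
  let ?E = "{(A, B). A \<in> ?V \<and> B \<in> ?V \<and> A \<inter> B = {}}"
  have fin: "finite ?V"
    by (simp add: finite_imp_finite_nsets)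
  have finE: "finite ?E"
    by (rule finite_subset[OF _ finite_cartesian_product[OF fin fin]]) auto
  have nonempty: "{} \<notin> ?V"
    using assms by (simp add: nsets_def)
  have "sym ?E"
    by (rule symI) (simp add: Int_commute)
  then have "symmetric (kneser_graph m n)"
    by (simp add: symmetric_def kneser_graph_def)
  then show ?thesis
    using fin finE nonempty
    by unfold_locales (auto simp: kneser_graph_def)
qed

(* The colour classes are the fibres of c over the colours 0, ..., t - 1; the condition on
   the image says that all t of them are nonempty. *)
definition proper_coloring :: "'a pair_pre_digraph \<Rightarrow> nat \<Rightarrow> ('a \<Rightarrow> nat) \<Rightarrow> bool" where
  "proper_coloring G t c \<longleftrightarrow>
     c ` pverts G = {..<t} \<and> (\<forall>(u, v) \<in> parcs G. c u \<noteq> c v)"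

definition b_coloring :: "'a pair_pre_digraph \<Rightarrow> nat \<Rightarrow> ('a \<Rightarrow> nat) \<Rightarrow> bool" where
  "b_coloring G t c \<longleftrightarrow>
     proper_coloring G t c \<and>
     (\<forall>i<t. \<exists>v \<in> pverts G. c v = i \<and>
        (\<forall>j<t. j \<noteq> i \<longrightarrow> (\<exists>w \<in> pverts G. (v, w) \<in> parcs G \<and> c w = j)))"

(* The maximum is over a finite set by the lemma below, and a nonempty one whenever G is a
   nonempty finite simple graph, since a proper colouring with the fewest possible colours
   is a b-colouring. *)
definition b_chromatic_number :: "'a pair_pre_digraph \<Rightarrow> nat" where
  "b_chromatic_number G = Max {t. t > 0 \<and> (\<exists>c. b_coloring G t c)}"

lemma finite_b_coloring_sizes:
  assumes "finite (pverts G)"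
  shows "finite {t. t > 0 \<and> (\<exists>c. b_coloring G t c)}"
proof (rule finite_subset)
  show "{t. t > 0 \<and> (\<exists>c. b_coloring G t c)} \<subseteq> {..card (pverts G)}"
  proof
    fix t assume "t \<in> {t. t > 0 \<and> (\<exists>c. b_coloring G t c)}"
    then obtain c where "c ` pverts G = {..<t}"
      by (auto simp: b_coloring_def proper_coloring_def)
    with card_image_le[OF assms, of c] show "t \<in> {..card (pverts G)}"
      by simp
  qed
qed simp

end

(* Put k = m div 2 and split 2k of the points into two copies of {0..<k}, so that a vertex
   becomes a pair (A, B) of subsets of {0..<k}.  The colours are pairs (T, s) with T an n-subset
   of {0..<k} and s a truth value.  A vertex with A and B disjoint gets the colour (A \<union> B, s):
   among such vertices with the same union it is disjoint only from (B, A), and s separates the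
   two.  Since n \<ge> 3, s can be chosen to be true on (T, {}) and on all ({x}, T - {x}); then
   (T, {}) is disjoint from a vertex of every other colour, and so by symmetry is ({}, T).
   A vertex with A and B not disjoint, x the least common point, meets every (C, D) with
   x \<in> C \<union> D, so it can take the colour of any T containing x; the choice of T must be injective
   in x, and cyclic intervals do this when k > n.  For k = n two colours suffice, according to
   whether the vertex contains 0.  If m is odd, all vertices containing the last point form one
   further colour class. *)
theory Submission
  imports Defs
begin

section \<open>Lower bounds from colourings with an arbitrary finite set of colours\<close>

text \<open>Transporting colours along a bijection from \<open>K\<close> to
  \<open>{..<card K}\<close> allows pairs, truth values and options as colours. That every colour
  occurs follows from \<open>dom\<close>.\<close>

lemma b_chromatic_number_ge_card:
  fixes G :: "'a pair_pre_digraph"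
  assumes fin: "finite (pverts G)" and K: "finite K" "K \<noteq> {}"
    and range: "\<And>v. v \<in> pverts G \<Longrightarrow> f v \<in> K"
    and proper: "\<And>u v. (u, v) \<in> parcs G \<Longrightarrow> f u \<noteq> f v"
    and arcs: "\<And>u v. (u, v) \<in> parcs G \<Longrightarrow> u \<in> pverts G \<and> v \<in> pverts G"
    and dom: "\<And>i. i \<in> K \<Longrightarrow> \<exists>v\<in>pverts G. f v = i \<and>
                (\<forall>j\<in>K. j \<noteq> i \<longrightarrow> (\<exists>w\<in>pverts G. (v, w) \<in> parcs G \<and> f w = j))"
  shows "card K \<le> b_chromatic_number G"
proof -
  obtain e where e: "bij_betw e K {..<card K}"
    using ex_bij_betw_finite_nat[OF K(1)] by (auto simp: atLeast0LessThan)
  have inj: "e x = e y \<longleftrightarrow> x = y" if "x \<in> K" "y \<in> K" for x y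
    using e that by (auto simp: bij_betw_def inj_on_def)
  have img: "e ` K = {..<card K}"
    using e by (simp add: bij_betw_def)
  have "f ` pverts G = K"
    using range dom by (auto simp: image_iff) metis
  then have "(e \<circ> f) ` pverts G = {..<card K}"
    by (metis image_comp img)
  moreover have "(e \<circ> f) u \<noteq> (e \<circ> f) v" if "(u, v) \<in> parcs G" for u v
    using that proper[OF that] arcs[OF that] range inj[of "f u" "f v"] by simp
  ultimately have "proper_coloring G (card K) (e \<circ> f)"
    by (auto simp: proper_coloring_def)
  moreover have "\<exists>v\<in>pverts G. (e \<circ> f) v = i \<and> (\<forall>j<card K. j \<noteq> i \<longrightarrow>
      (\<exists>w\<in>pverts G. (v, w) \<in> parcs G \<and> (e \<circ> f) w = j))" if "i < card K" for i
  proof -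
    have "i \<in> e ` K"
      using img that by simp
    then obtain i' where i': "i' \<in> K" "i = e i'"
      by blast
    obtain v where v: "v \<in> pverts G" "f v = i'"
      "\<And>j. j \<in> K \<Longrightarrow> j \<noteq> i' \<Longrightarrow> \<exists>w\<in>pverts G. (v, w) \<in> parcs G \<and> f w = j"
      using dom[OF i'(1)] by blast
    have "\<exists>w\<in>pverts G. (v, w) \<in> parcs G \<and> (e \<circ> f) w = j" if "j < card K" "j \<noteq> i" for j
    proof -
      have "j \<in> e ` K"
        using img \<open>j < card K\<close> by simp
      then obtain j' where j': "j' \<in> K" "j = e j'"
        by blast
      then show ?thesis
        using v(3)[of j'] that i' by auto
    qed
    then show ?thesis
      using v i' by auto
  qed
  ultimately have "b_coloring G (card K) (e \<circ> f)"
    by (simp add: b_coloring_def)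
  moreover have "card K > 0"
    using K by (simp add: card_gt_0_iff)
  ultimately show ?thesis
    unfolding b_chromatic_number_def
    by (intro Max_ge[OF finite_b_coloring_sizes[OF fin]]) auto
qed

lemma kneser_graph_b_chromatic_ge_card:
  assumes K: "finite K" "K \<noteq> {}"
    and range: "\<And>V. V \<in> nsets {0..<m} n \<Longrightarrow> f V \<in> K"
    and proper: "\<And>V W. V \<in> nsets {0..<m} n \<Longrightarrow> W \<in> nsets {0..<m} n \<Longrightarrow> V \<inter> W = {} \<Longrightarrow> f V \<noteq> f W"
    and dom: "\<And>i. i \<in> K \<Longrightarrow> \<exists>V\<in>nsets {0..<m} n. f V = i \<and>
                (\<forall>j\<in>K. j \<noteq> i \<longrightarrow> (\<exists>W\<in>nsets {0..<m} n. V \<inter> W = {} \<and> f W = j))"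
  shows "card K \<le> b_chromatic_number (kneser_graph m n)"
proof (rule b_chromatic_number_ge_card[where f = f])
  show "finite (pverts (kneser_graph m n))"
    by (simp add: kneser_graph_def finite_imp_finite_nsets)
next
  fix i assume "i \<in> K"
  from dom[OF this] show "\<exists>v\<in>pverts (kneser_graph m n). f v = i \<and> (\<forall>j\<in>K. j \<noteq> i \<longrightarrow>
      (\<exists>w\<in>pverts (kneser_graph m n). (v, w) \<in> parcs (kneser_graph m n) \<and> f w = j))"
    by (simp add: kneser_graph_def)
qed (use K range proper in \<open>auto simp: kneser_graph_def\<close>)

text \<open>Vertices containing the new point \<open>m\<close> pairwise intersect, so they can share
  the new colour \<open>None\<close>, with dominating vertex \<open>insert m X\<close>. This gives
  \<open>card K + 1\<close> colours; the conclusion keeps only \<open>card K\<close> of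
  them.\<close>

lemma kneser_graph_Suc_b_chromatic_ge_card:
  assumes K: "finite K" "K \<noteq> {}" and n: "n \<ge> 1" "m \<ge> 2 * n"
    and range: "\<And>V. V \<in> nsets {0..<m} n \<Longrightarrow> f V \<in> K"
    and proper: "\<And>V W. V \<in> nsets {0..<m} n \<Longrightarrow> W \<in> nsets {0..<m} n \<Longrightarrow> V \<inter> W = {} \<Longrightarrow> f V \<noteq> f W"
    and dom: "\<And>i. i \<in> K \<Longrightarrow> \<exists>V\<in>nsets {0..<m} n. f V = i \<and>
                (\<forall>j\<in>K. j \<noteq> i \<longrightarrow> (\<exists>W\<in>nsets {0..<m} n. V \<inter> W = {} \<and> f W = j))"
    and X: "X \<in> nsets {0..<m} (n - 1)" "\<And>j. j \<in> K \<Longrightarrow> \<exists>W\<in>nsets {0..<m} n. X \<inter> W = {} \<and> f W = j"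
  shows "card K \<le> b_chromatic_number (kneser_graph (Suc m) n)"
proof -
  define g where "g = (\<lambda>V. if m \<in> V then None else Some (f V))"
  have sub: "V \<in> nsets {0..<Suc m} n" "m \<notin> V" if "V \<in> nsets {0..<m} n" for V
    using that by (auto simp: nsets_def)
  have sub': "V \<in> nsets {0..<m} n" if "V \<in> nsets {0..<Suc m} n" "m \<notin> V" for V
  proof -
    have "V \<subseteq> {0..<m}"
      using that by (auto simp: nsets_def less_Suc_eq)
    then show ?thesis
      using that by (simp add: nsets_def)
  qed
  have ins: "insert m Y \<in> nsets {0..<Suc m} n" if "Y \<in> nsets {0..<m} (n - 1)" for Y
    using that n by (auto simp: nsets_def card_insert_if)
  have "card (insert None (Some ` K)) \<le> b_chromatic_number (kneser_graph (Suc m) n)"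
  proof (rule kneser_graph_b_chromatic_ge_card[where f = g])
    fix i assume i: "i \<in> insert None (Some ` K)"
    show "\<exists>V\<in>nsets {0..<Suc m} n. g V = i \<and> (\<forall>j\<in>insert None (Some ` K). j \<noteq> i \<longrightarrow>
            (\<exists>W\<in>nsets {0..<Suc m} n. V \<inter> W = {} \<and> g W = j))"
    proof (cases i)
      case None
      have "\<exists>W\<in>nsets {0..<Suc m} n. insert m X \<inter> W = {} \<and> g W = Some j" if j: "j \<in> K" for j
      proof -
        from X(2)[OF j] obtain W where "W \<in> nsets {0..<m} n" "X \<inter> W = {}" "f W = j" by blast
        then show ?thesis
          using sub by (intro bexI[of _ W]) (auto simp: g_def)
      qed
      then show ?thesis
        using None ins[OF X(1)] by (intro bexI[of _ "insert m X"]) (auto simp: g_def)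
    next
      case (Some i')
      then have "i' \<in> K" using i by auto
      from dom[OF this] obtain V where V: "V \<in> nsets {0..<m} n" "f V = i'"
        "\<And>j. j \<in> K \<Longrightarrow> j \<noteq> i' \<Longrightarrow> \<exists>W\<in>nsets {0..<m} n. V \<inter> W = {} \<and> f W = j" by blast
      have old: "\<exists>W\<in>nsets {0..<Suc m} n. V \<inter> W = {} \<and> g W = Some j" if "j \<in> K" "j \<noteq> i'" for j
      proof -
        from V(3)[OF that] obtain W where "W \<in> nsets {0..<m} n" "V \<inter> W = {}" "f W = j" by blast
        then show ?thesis
          using sub by (intro bexI[of _ W]) (auto simp: g_def)
      qed
      \<comment> \<open>The old dominating vertex \<open>V\<close> must now also see colour
        \<open>None\<close>. At least \<open>m - n \<ge> n\<close> old points lie outside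
        \<open>V\<close>, enough to complete \<open>m\<close> to a vertex disjoint from
        \<open>V\<close>.\<close>
      have "card ({0..<m} - V) \<ge> n - 1"
        using V(1) n by (auto simp: nsets_def card_Diff_subset)
      then obtain Y where Y: "Y \<subseteq> {0..<m} - V" "card Y = n - 1" "finite Y"
        by (meson obtain_subset_with_card_n)
      then have "insert m Y \<in> nsets {0..<Suc m} n"
        by (intro ins) (auto simp: nsets_def)
      moreover have "V \<inter> insert m Y = {}" "g (insert m Y) = None"
        using Y sub(2)[OF V(1)] by (auto simp: g_def)
      ultimately have "\<exists>W\<in>nsets {0..<Suc m} n. V \<inter> W = {} \<and> g W = None" by blast
      with old have "\<forall>j\<in>insert None (Some ` K). j \<noteq> i \<longrightarrow>
            (\<exists>W\<in>nsets {0..<Suc m} n. V \<inter> W = {} \<and> g W = j)"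
        using Some by auto
      moreover have "g V = i"
        using sub(2)[OF V(1)] V(2) Some by (simp add: g_def)
      ultimately show ?thesis
        using sub(1)[OF V(1)] by blast
    qed
  next
    show "g V \<in> insert None (Some ` K)" if "V \<in> nsets {0..<Suc m} n" for V
      using range sub'[OF that] by (auto simp: g_def)
  next
    fix V W assume "V \<in> nsets {0..<Suc m} n" "W \<in> nsets {0..<Suc m} n" "V \<inter> W = {}"
    then show "g V \<noteq> g W"
      using proper[of V W] sub' by (auto simp: g_def)
  qed (use K in auto)
  then show ?thesis
    using K by (simp add: card_image card_insert_if image_iff)
qed

section \<open>Cyclic intervals modulo k\<close>

definition cyclic_interval :: "nat \<Rightarrow> nat \<Rightarrow> nat \<Rightarrow> nat set" where
  "cyclic_interval k n x = {x..<min k (x + n)} \<union> {0..<x + n - k}"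

lemma cyclic_interval_in_nsets:
  assumes "n \<le> k" "x < k"
  shows "cyclic_interval k n x \<in> nsets {0..<k} n"
proof -
  \<comment> \<open>As \<open>n \<le> k\<close>, the wrapped piece stops at or before
    \<open>x\<close>; truncated subtraction makes it empty when
    \<open>x + n \<le> k\<close>.\<close>
  have "{x..<min k (x + n)} \<inter> {0..<x + n - k} = {}"
    using assms by auto
  then have "card (cyclic_interval k n x) = n"
    using assms by (auto simp: cyclic_interval_def card_Un_disjoint min_def)
  then show ?thesis
    using assms by (auto simp: nsets_def cyclic_interval_def)
qed

lemma start_in_cyclic_interval: "0 < n \<Longrightarrow> x < k \<Longrightarrow> x \<in> cyclic_interval k n x"
  by (simp add: cyclic_interval_def)

text \<open>The starting point is recognisable as the one member whose cyclic predecessor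
  \<open>p\<close> is missing. For \<open>n = k\<close> nothing is missing and all intervals
  coincide, hence \<open>n < k\<close>.\<close>

lemma cyclic_interval_inject:
  assumes "0 < n" "n < k" "x < k" "y < k" "cyclic_interval k n x = cyclic_interval k n y"
  shows "x = y"
proof (rule ccontr)
  assume "x \<noteq> y"
  define p where "p = (if x = 0 then k - 1 else x - 1)"
  have "x \<in> cyclic_interval k n y"
    using start_in_cyclic_interval assms by blast
  then have "p \<in> cyclic_interval k n y"
    using assms(1-4) \<open>x \<noteq> y\<close> by (auto simp: cyclic_interval_def p_def split: if_splits)
  moreover have "p \<notin> cyclic_interval k n x"
    using assms(1-4) by (auto simp: cyclic_interval_def p_def split: if_splits)
  ultimately show False
    using assms by simp
qed

section \<open>Vertices as pairs of subsets of one k-element set\<close>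

definition lower_part :: "nat \<Rightarrow> nat set \<Rightarrow> nat set" where
  "lower_part k W = W \<inter> {0..<k}"

text \<open>Shifted down by \<open>k\<close>, so that it can be intersected and united with the
  lower part.\<close>

definition upper_part :: "nat \<Rightarrow> nat set \<Rightarrow> nat set" where
  "upper_part k W = {x. x < k \<and> x + k \<in> W}"

definition glue :: "nat \<Rightarrow> nat set \<Rightarrow> nat set \<Rightarrow> nat set" where
  "glue k A B = A \<union> (\<lambda>x. x + k) ` B"

lemma parts_glue [simp]:
  assumes "A \<subseteq> {0..<k}" "B \<subseteq> {0..<k}"
  shows "lower_part k (glue k A B) = A" "upper_part k (glue k A B) = B"
  using assms by (auto simp: lower_part_def upper_part_def glue_def)

lemma glue_disjoint:
  assumes "A \<subseteq> {0..<k}" "B \<subseteq> {0..<k}" "C \<subseteq> {0..<k}" "D \<subseteq> {0..<k}" "A \<inter> C = {}" "B \<inter> D = {}"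
  shows "glue k A B \<inter> glue k C D = {}"
  using assms by (fastforce simp: glue_def)

lemma glue_parts:
  assumes "W \<subseteq> {0..<2 * k}"
  shows "glue k (lower_part k W) (upper_part k W) = W"
proof -
  have "x \<in> (\<lambda>x. x + k) ` upper_part k W" if "x \<in> W" "\<not> x < k" for x
    using assms that by (intro image_eqI[of _ _ "x - k"]) (auto simp: upper_part_def)
  moreover have "(\<lambda>x. x + k) ` upper_part k W \<subseteq> W"
    by (auto simp: upper_part_def)
  ultimately show ?thesis
    unfolding glue_def lower_part_def by fastforce
qed

lemma card_glue:
  assumes "A \<subseteq> {0..<k}" "B \<subseteq> {0..<k}"
  shows "card (glue k A B) = card A + card B"
proof -
  have "finite A" "finite B" "A \<inter> (\<lambda>x. x + k) ` B = {}"
    using assms finite_subset by fastforce+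
  then show ?thesis
    by (simp add: glue_def card_Un_disjoint card_image)
qed

lemma glue_in_nsets:
  assumes "A \<subseteq> {0..<k}" "B \<subseteq> {0..<k}" "card A + card B = n"
  shows "glue k A B \<in> nsets {0..<2 * k} n"
proof -
  have "glue k A B \<subseteq> {0..<2 * k}"
    using assms by (force simp: glue_def)
  then show ?thesis
    using card_glue[OF assms(1,2)] assms(3) by (auto simp: nsets_def intro: finite_subset)
qed

section \<open>The colouring of pairs\<close>

text \<open>The first two alternatives prescribe truth on \<open>(T, {})\<close> and
  \<open>({x}, T - {x})\<close>; the conditions \<open>card A \<noteq> 0\<close> and
  \<open>card B \<noteq> 1\<close> keep the swapped pairs false. The position of the minimum decides
  all remaining pairs.\<close>

definition side :: "nat set \<Rightarrow> nat set \<Rightarrow> bool" where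
  "side A B \<longleftrightarrow> card B = 0 \<or> card A = 1 \<or> card A \<noteq> 0 \<and> card B \<noteq> 1 \<and> Min (A \<union> B) \<in> A"

text \<open>A pair and its swap could both be prescribed true only if both sets are empty or both
  are singletons, which total size at least 3 excludes. In the undecided cases the minimum lies in
  exactly one of the two disjoint sets.\<close>

lemma side_swap:
  assumes "finite A" "finite B" "A \<inter> B = {}" "card A + card B \<ge> 3"
  shows "side B A \<longleftrightarrow> \<not> side A B"
proof -
  have "A \<union> B \<noteq> {}"
    using assms(4) by auto
  then have "Min (A \<union> B) \<in> A \<union> B"
    using assms by (intro Min_in) auto
  then have "Min (A \<union> B) \<in> B \<longleftrightarrow> Min (A \<union> B) \<notin> A"
    using assms(3) by blast
  moreover have "B \<union> A = A \<union> B"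
    by blast
  ultimately show ?thesis
    using assms(4) by (auto simp: side_def)
qed

text \<open>The flag \<open>True\<close> on overlapping pairs is an arbitrary choice: properness
  there comes from the first component alone.\<close>

definition pair_color :: "nat \<Rightarrow> nat \<Rightarrow> nat set \<Rightarrow> nat set \<Rightarrow> nat set \<times> bool" where
  "pair_color k n A B =
     (if A \<inter> B = {} then (A \<union> B, side A B) else (cyclic_interval k n (Min (A \<inter> B)), True))"

lemma pair_color_proper:
  assumes n: "3 \<le> n" "n < k"
    and sub: "A \<subseteq> {0..<k}" "B \<subseteq> {0..<k}" "C \<subseteq> {0..<k}" "D \<subseteq> {0..<k}"
    and card: "card A + card B = n" and disj: "A \<inter> C = {}" "B \<inter> D = {}"
  shows "pair_color k n A B \<noteq> pair_color k n C D"
proof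
  assume eq: "pair_color k n A B = pair_color k n C D"
  have fin: "finite A" "finite B" "finite C" "finite D"
    using sub finite_subset by blast+
  have Min: "Min (P \<inter> Q) \<in> P \<and> Min (P \<inter> Q) \<in> Q \<and> Min (P \<inter> Q) < k
      \<and> Min (P \<inter> Q) \<in> cyclic_interval k n (Min (P \<inter> Q))"
    if "P \<inter> Q \<noteq> {}" "finite P" "P \<subseteq> {0..<k}" for P Q
  proof -
    have "Min (P \<inter> Q) \<in> P \<inter> Q"
      using that by (intro Min_in) auto
    moreover from this have "Min (P \<inter> Q) < k"
      using that(3) by auto
    ultimately show ?thesis
      using start_in_cyclic_interval[of n "Min (P \<inter> Q)" k] n by auto
  qed
  show False
  proof (cases "A \<inter> B = {}"; cases "C \<inter> D = {}")
    assume "A \<inter> B = {}" "C \<inter> D = {}"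
    moreover from this eq have "A \<union> B = C \<union> D" "side A B = side C D"
      by (auto simp: pair_color_def)
    \<comment> \<open>A point of \<open>C\<close> lies in \<open>A \<union> B\<close> but not in
      \<open>A\<close>, and a point of \<open>B\<close> lies in \<open>C \<union> D\<close> but not
      in \<open>D\<close>; likewise for \<open>D\<close> and \<open>A\<close>.\<close>
    moreover from calculation disj have "C = B" "D = A"
      by blast+
    ultimately show False
      using side_swap[of A B] fin card n by simp
  next
    assume a: "A \<inter> B = {}" "C \<inter> D \<noteq> {}"
    \<comment> \<open>The minimum starts its own interval, so it lies in \<open>A\<close> or
      \<open>B\<close>; being in both \<open>C\<close> and \<open>D\<close>, it violates one of the
      disjointness assumptions.\<close>
    then have "cyclic_interval k n (Min (C \<inter> D)) = A \<union> B"
      using eq by (simp add: pair_color_def)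
    then show False
      using Min[OF a(2)] fin sub disj by blast
  next
    assume a: "A \<inter> B \<noteq> {}" "C \<inter> D = {}"
    then have "cyclic_interval k n (Min (A \<inter> B)) = C \<union> D"
      using eq by (simp add: pair_color_def)
    then show False
      using Min[OF a(1)] fin sub disj by blast
  next
    assume a: "A \<inter> B \<noteq> {}" "C \<inter> D \<noteq> {}"
    then have "cyclic_interval k n (Min (A \<inter> B)) = cyclic_interval k n (Min (C \<inter> D))"
      using eq by (simp add: pair_color_def)
    \<comment> \<open>This common value lies in all four sets, contrary to
      \<open>A \<inter> C = {}\<close>.\<close>
    then have "Min (A \<inter> B) = Min (C \<inter> D)"
      using cyclic_interval_inject[of n k] Min[OF a(1)] Min[OF a(2)] fin sub n by simp
    then show False
      using Min[OF a(1)] Min[OF a(2)] fin sub disj by (metis disjoint_iff)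
  qed
qed

text \<open>\<open>U\<close> will be the lower part of a vertex with empty upper part, so only
  \<open>A\<close> has to avoid it. For false \<open>s\<close> the pair \<open>({}, T)\<close>
  works. For true \<open>s\<close> use \<open>({x}, T - {x})\<close> with \<open>x\<close> in
  \<open>T\<close> outside \<open>U\<close>: if \<open>T \<subseteq> U\<close>, the sizes would
  force \<open>U = T\<close>.\<close>

lemma exists_pair_color_avoiding:
  assumes n: "3 \<le> n" and T: "T \<in> nsets {0..<k} n"
    and U: "finite U" "card U \<le> n" "s \<Longrightarrow> U \<noteq> T"
  obtains A B where "A \<subseteq> {0..<k}" "B \<subseteq> {0..<k}" "card A + card B = n"
    "A \<inter> B = {}" "U \<inter> A = {}" "pair_color k n A B = (T, s)"
proof (cases s)
  case True
  have T': "T \<subseteq> {0..<k}" "finite T" "card T = n"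
    using T by (auto simp: nsets_def)
  then obtain x where x: "x \<in> T" "x \<notin> U"
    using card_seteq[of U T] U True by auto
  then have "{x} \<inter> (T - {x}) = {}" "{x} \<union> (T - {x}) = T" "side {x} (T - {x})"
    by (auto simp: side_def)
  then have "pair_color k n {x} (T - {x}) = (T, s)"
    using True by (simp add: pair_color_def)
  then show thesis
    using that[of "{x}" "T - {x}"] x T' n by (simp add: card_Diff_singleton subset_iff)
next
  case False
  have T': "T \<subseteq> {0..<k}" "finite T" "card T = n"
    using T by (auto simp: nsets_def)
  then have "\<not> side {} T"
    using n by (simp add: side_def)
  then show thesis
    using that[of "{}" T] T' False by (auto simp: pair_color_def)
qed

lemma pair_color_swap:
  assumes "finite A" "finite B" "card A + card B \<ge> 3" "A \<inter> B = {}"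
    "pair_color k n A B = (T, s)"
  shows "pair_color k n B A = (T, \<not> s)"
  using assms side_swap[of A B] by (auto simp: pair_color_def Int_commute)

section \<open>Halves with more than n points\<close>

lemma kneser_graph_halves_b_chromatic_ge:
  assumes n: "3 \<le> n" "n < k" and m: "m = 2 * k \<or> m = Suc (2 * k)"
  shows "2 * (k choose n) \<le> b_chromatic_number (kneser_graph m n)"
proof -
  define f where "f = (\<lambda>W. pair_color k n (lower_part k W) (upper_part k W))"
  define K where "K = nsets {0..<k} n \<times> (UNIV :: bool set)"
  have f_glue: "f (glue k A B) = pair_color k n A B" if "A \<subseteq> {0..<k}" "B \<subseteq> {0..<k}" for A B
    using that by (simp add: f_def)
  have parts: "lower_part k W \<subseteq> {0..<k}" "upper_part k W \<subseteq> {0..<k}"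
      "card (lower_part k W) + card (upper_part k W) = n" if "W \<in> nsets {0..<2 * k} n" for W
  proof -
    show sub: "lower_part k W \<subseteq> {0..<k}" "upper_part k W \<subseteq> {0..<k}"
      by (auto simp: lower_part_def upper_part_def)
    show "card (lower_part k W) + card (upper_part k W) = n"
      using card_glue[OF sub] glue_parts[of W k] that by (simp add: nsets_def)
  qed
  have card_K: "card K = 2 * (k choose n)"
    by (simp add: K_def card_cartesian_product card_nsets)
  have K: "finite K" "K \<noteq> {}"
  proof -
    show "finite K"
      by (simp add: K_def finite_imp_finite_nsets)
    have "card K > 0"
      using card_K n by simp
    then show "K \<noteq> {}"
      by auto
  qed
  have range: "f W \<in> K" if "W \<in> nsets {0..<2 * k} n" for W
  proof (cases "lower_part k W \<inter> upper_part k W = {}")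
    case True
    note p = parts[OF that]
    have fin: "finite (lower_part k W)" "finite (upper_part k W)"
      using p(1,2) finite_subset by blast+
    then have "card (lower_part k W \<union> upper_part k W) = n"
      using p True by (simp add: card_Un_disjoint)
    then show ?thesis
      using True fin p by (auto simp: f_def pair_color_def K_def nsets_def)
  next
    case False
    have "finite (lower_part k W)"
      by (simp add: lower_part_def)
    then have "Min (lower_part k W \<inter> upper_part k W) \<in> lower_part k W \<inter> upper_part k W"
      using False by (intro Min_in) auto
    then have "Min (lower_part k W \<inter> upper_part k W) < k"
      using parts(1)[OF that] by auto
    then show ?thesis
      using False cyclic_interval_in_nsets[of n k] n by (simp add: f_def pair_color_def K_def)
  qed
  have proper: "f V \<noteq> f W"
    if "V \<in> nsets {0..<2 * k} n" "W \<in> nsets {0..<2 * k} n" "V \<inter> W = {}" for V W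
    using that(3) pair_color_proper[OF n parts(1,2)[OF that(1)] parts(1,2)[OF that(2)] parts(3)[OF that(1)]]
    by (auto simp: f_def lower_part_def upper_part_def)
  have avoid_lower: "\<exists>W\<in>nsets {0..<2 * k} n. glue k U {} \<inter> W = {} \<and> f W = (T, s)"
    if "T \<in> nsets {0..<k} n" "U \<subseteq> {0..<k}" "card U \<le> n" "s \<Longrightarrow> U \<noteq> T" for T U s
  proof -
    have "finite U"
      using that(2) finite_subset by blast
    from exists_pair_color_avoiding[OF n(1) that(1) this that(3,4)] obtain A B where
      "A \<subseteq> {0..<k}" "B \<subseteq> {0..<k}" "card A + card B = n" "U \<inter> A = {}" "pair_color k n A B = (T, s)"
      by metis
    then show ?thesis
      using that(2) by (intro bexI[of _ "glue k A B"]) (auto simp: f_glue glue_disjoint glue_in_nsets)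
  qed
  \<comment> \<open>Mirror image of \<open>avoid_lower\<close>: take a pair of colour
    \<open>(T, \<not> s)\<close> whose first set avoids \<open>U\<close> and exchange its halves.
    The swap negates the flag, which is why the exceptional case here is
    \<open>\<not> s\<close>.\<close>
  have avoid_upper: "\<exists>W\<in>nsets {0..<2 * k} n. glue k {} U \<inter> W = {} \<and> f W = (T, s)"
    if "T \<in> nsets {0..<k} n" "U \<subseteq> {0..<k}" "card U \<le> n" "\<not> s \<Longrightarrow> U \<noteq> T" for T U s
  proof -
    have "finite U"
      using that(2) finite_subset by blast
    from exists_pair_color_avoiding[OF n(1) that(1) this that(3,4)] obtain A B where AB:
      "A \<subseteq> {0..<k}" "B \<subseteq> {0..<k}" "card A + card B = n" "A \<inter> B = {}" "U \<inter> A = {}"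
      "pair_color k n A B = (T, \<not> s)"
      by metis
    then have "pair_color k n B A = (T, s)"
      using pair_color_swap[of A B k n T "\<not> s"] n by (auto intro: finite_subset)
    then show ?thesis
      using that(2) AB
      by (intro bexI[of _ "glue k B A"]) (auto simp: f_glue glue_disjoint glue_in_nsets)
  qed
  have dom: "\<exists>V\<in>nsets {0..<2 * k} n. f V = i \<and>
      (\<forall>j\<in>K. j \<noteq> i \<longrightarrow> (\<exists>W\<in>nsets {0..<2 * k} n. V \<inter> W = {} \<and> f W = j))" if "i \<in> K" for i
  proof -
    obtain T s where i: "i = (T, s)" "T \<in> nsets {0..<k} n"
      using \<open>i \<in> K\<close> unfolding K_def by blast
    then have T: "T \<subseteq> {0..<k}" "card T = n" "finite T"
      by (auto simp: nsets_def)
    show ?thesis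
    \<comment> \<open>The dominating vertex of colour \<open>(T, s)\<close> is \<open>T\<close>
      placed wholly in the lower half if \<open>s\<close> is true, and wholly in the upper half
      otherwise.\<close>
    proof (cases s)
      case True
      have "f (glue k T {}) = i"
        using T True i by (simp add: f_glue pair_color_def side_def)
      moreover have "\<exists>W\<in>nsets {0..<2 * k} n. glue k T {} \<inter> W = {} \<and> f W = j"
        if "j \<in> K" "j \<noteq> i" for j
      proof -
        have "fst j \<in> nsets {0..<k} n" "snd j \<Longrightarrow> T \<noteq> fst j"
          using that True i by (auto simp: K_def)
        then show ?thesis
          using avoid_lower[of "fst j" T "snd j"] T by simp
      qed
      ultimately show ?thesis
        using glue_in_nsets[of T k "{}" n] T by auto
    next
      case False
      have "f (glue k {} T) = i"
        using T False i n by (simp add: f_glue pair_color_def side_def)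
      moreover have "\<exists>W\<in>nsets {0..<2 * k} n. glue k {} T \<inter> W = {} \<and> f W = j"
        if "j \<in> K" "j \<noteq> i" for j
      proof -
        have "fst j \<in> nsets {0..<k} n" "\<not> snd j \<Longrightarrow> T \<noteq> fst j"
          using that False i by (auto simp: K_def)
        then show ?thesis
          using avoid_upper[of "fst j" T "snd j"] T by simp
      qed
      ultimately show ?thesis
        using glue_in_nsets[of "{}" k T n] T by auto
    qed
  qed
  \<comment> \<open>Used for odd \<open>m\<close>. Any \<open>n - 1\<close> points of the lower half
    would do: their number differs from \<open>n\<close>, so they never form a colour set
    \<open>T\<close> and no colour is exceptional in \<open>avoid_lower\<close>.\<close>
  have X: "glue k {0..<n - 1} {} \<in> nsets {0..<2 * k} (n - 1)"
    using n by (intro glue_in_nsets) auto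
  have avoid_X: "\<exists>W\<in>nsets {0..<2 * k} n. glue k {0..<n - 1} {} \<inter> W = {} \<and> f W = j" if "j \<in> K" for j
  proof -
    have "card (fst j) = n"
      using that by (auto simp: K_def nsets_def)
    moreover have "card {0..<n - 1} \<noteq> n"
      using n by simp
    ultimately have "{0..<n - 1} \<noteq> fst j"
      by metis
    then show ?thesis
      using avoid_lower[of "fst j" "{0..<n - 1}" "snd j"] that n by (simp add: K_def mem_Times_iff)
  qed
  from m show ?thesis
  proof
    assume "m = 2 * k"
    then show ?thesis
      using kneser_graph_b_chromatic_ge_card[OF K range proper dom] unfolding card_K by blast
  next
    assume "m = Suc (2 * k)"
    moreover have "1 \<le> n" "2 * n \<le> 2 * k"
      using n by simp_all
    ultimately show ?thesis
      using kneser_graph_Suc_b_chromatic_ge_card[OF K _ _ range proper dom X avoid_X]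
      unfolding card_K by blast
  qed
qed

section \<open>Halves with exactly n points\<close>

lemma kneser_graph_double_b_chromatic_ge:
  assumes n: "1 \<le> n" and m: "m = 2 * n \<or> m = Suc (2 * n)"
  shows "2 \<le> b_chromatic_number (kneser_graph m n)"
proof -
  define f where "f = (\<lambda>W :: nat set. 0 \<in> W)"
  have compl: "{0..<2 * n} - V \<in> nsets {0..<2 * n} n" if "V \<in> nsets {0..<2 * n} n" for V
    using that by (auto simp: nsets_def card_Diff_subset)
  have proper: "f V \<noteq> f W"
    if V: "V \<in> nsets {0..<2 * n} n" and W: "W \<in> nsets {0..<2 * n} n" and "V \<inter> W = {}" for V W
  proof -
    have "W \<subseteq> {0..<2 * n} - V"
      using that by (auto simp: nsets_def)
    \<comment> \<open>Both sides have \<open>n\<close> elements. Disjoint vertices are thus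
      complementary, and exactly one of them contains 0.\<close>
    then have "W = {0..<2 * n} - V"
      using compl[OF V] W by (intro card_subset_eq) (auto simp: nsets_def)
    then show ?thesis
      using n by (auto simp: f_def)
  qed
  have low: "{0..<n} \<in> nsets {0..<2 * n} n" "{n..<2 * n} \<in> nsets {0..<2 * n} n"
    by (auto simp: nsets_def)
  have disj: "{0..<n} \<inter> {n..<2 * n} = {}" "{n..<2 * n} \<inter> {0..<n} = {}"
    by auto
  have f: "f {0..<n}" "\<not> f {n..<2 * n}"
    using n by (auto simp: f_def)
  have dom: "\<exists>V\<in>nsets {0..<2 * n} n. f V = i \<and>
      (\<forall>j\<in>UNIV. j \<noteq> i \<longrightarrow> (\<exists>W\<in>nsets {0..<2 * n} n. V \<inter> W = {} \<and> f W = j))" for i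
    using low disj f by (cases i) (metis (full_types))+
  \<comment> \<open>This set leaves the \<open>n + 1\<close> points 0 and \<open>n\<close>, ...,
    \<open>2 * n - 1\<close> free: omitting \<open>n\<close> gives a vertex with 0, omitting 0 gives
    one without.\<close>
  have X: "{1..<n} \<in> nsets {0..<2 * n} (n - 1)"
    by (auto simp: nsets_def)
  have avoid_X: "\<exists>W\<in>nsets {0..<2 * n} n. {1..<n} \<inter> W = {} \<and> f W = j" for j
  proof (cases j)
    case True
    have "insert 0 {Suc n..<2 * n} \<in> nsets {0..<2 * n} n"
      using n by (auto simp: nsets_def)
    then show ?thesis
      using True by (intro bexI[of _ "insert 0 {Suc n..<2 * n}"]) (auto simp: f_def)
  next
    case False
    then show ?thesis
      using low f by (intro bexI[of _ "{n..<2 * n}"]) auto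
  qed
  from m show ?thesis
  proof
    assume "m = 2 * n"
    moreover have "card (UNIV :: bool set) \<le> b_chromatic_number (kneser_graph (2 * n) n)"
      by (rule kneser_graph_b_chromatic_ge_card[OF _ _ _ proper dom]) simp_all
    ultimately show ?thesis
      by simp
  next
    assume "m = Suc (2 * n)"
    moreover have "card (UNIV :: bool set) \<le> b_chromatic_number (kneser_graph (Suc (2 * n)) n)"
      by (rule kneser_graph_Suc_b_chromatic_ge_card[OF _ _ n _ _ proper dom X avoid_X]) simp_all
    ultimately show ?thesis
      by simp
  qed
qed

theorem theorem1:
  fixes m n :: nat
  assumes "n \<ge> 3" and "m \<ge> 2 * n"
  shows "b_chromatic_number (kneser_graph m n) \<ge> 2 * ((m div 2) choose n)"
proof (cases "m div 2 = n")
  case True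
  then have "m = 2 * n \<or> m = Suc (2 * n)"
    by presburger
  \<comment> \<open>Here \<open>n choose n\<close> is 1, so the claimed bound is just 2.\<close>
  then show ?thesis
    using kneser_graph_double_b_chromatic_ge[of n m] assms True by simp
next
  case False
  then have "n < m div 2"
    using assms by linarith
  moreover have "m = 2 * (m div 2) \<or> m = Suc (2 * (m div 2))"
    by presburger
  ultimately show ?thesis
    using kneser_graph_halves_b_chromatic_ge[of n "m div 2" m] assms by blast
qed

end
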